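(* Let $\Bbbk$ be a field, $d\ge 1$, $\Lambda=\Bbbk[[x_1,\dots,x_d]]$, and let $p,q\ge 1$ be integers. Let $L$ be a $\Lambda$-submodule of $\Lambda^p$, let $s_1,\dots,s_q\in L$ be non-zero elements, and let $\prec$ be a monomial order over $\mathrm{mon}(\Lambda^p)$. The following three conditions are equivalent: 1. the set $\{s_1,\dots,s_q\}$ is a standard basis of $L$ with respect to $\prec$; 2. the set $\{s_1,\dots,s_q\}$ generates $L$ as a $\Lambda$-module, and for every $f\in\Lambda^p$ there exists a unique $r\in\Lambda^p$ such that $f-r\in L$ and $\mathrm{supp}(r)\cap\langle \mathrm{lm}(\{s_1,\dots,s_q\})\rangle=\emptyset$; 3. every non-zero $f\in L$ has a standard representation with respect to $\{s_1,\dots,s_q\}$ and $\prec$.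
   Context: Monomials of $\Lambda$ are $x^\mu=x_1^{\mu_1}\cdots x_d^{\mu_d}$, $\mu\in\mathbb N^d$; they form the free commutative monoid $[x_1,\dots,x_d]$. A monomial order over $[x_1,\dots,x_d]$ is a total order $\prec$ such that $1\prec x^\mu$ for every $x^\mu\neq 1$, and $x^\mu\prec x^{\mu'}$ implies $x^{\mu+\nu}\prec x^{\mu'+\nu}$ for all $\nu\in\mathbb N^d$. For $r\ge1$, let $e_{r,1},\dots,e_{r,r}$ be the canonical basis of $\Lambda^r$ and $\mathrm{mon}(\Lambda^r)=\{x^\mu e_{r,i}\mid \mu\in\mathbb N^d,\ 1\le i\le r\}$. A monomial order over $\mathrm{mon}(\Lambda^r)$ is a total order $\prec$ on this set which is compatible with some monomial order, also written $\prec$, over $[x_1,\dots,x_d]$, in the following sense: (i) $x^\mu\prec x^\nu$ implies $x^\mu e_{r,i}\prec x^\nu e_{r,i}$ for every $i$; (ii) $x^\mu e_{r,i}\prec x^{\mu'}e_{r,j}$ implies $x^{\mu+\nu}e_{r,i}\prec x^{\mu'+\nu}e_{r,j}$ for every $\nu\in\mathbb N^d$. Such an order is a well-order. For $f\in\Lambda^r$, $\mathrm{supp}(f)\subseteq\mathrm{mon}(\Lambda^r)$ is the set of monomials having non-zero coefficient in $f$. For $f\ne0$, the leading monomial is the smallest monomial of the support: $\mathrm{lm}(f)=\min_\prec \mathrm{supp}(f)$. For $S\subseteq\Lambda^r$, $\mathrm{lm}(S)=\{\mathrm{lm}(f)\mid f\in S\setminus\{0\}\}$. The monoid $[x_1,\dots,x_d]$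 acts on $\mathrm{mon}(\Lambda^r)$ by $x^\mu\cdot x^\nu e_{r,i}=x^{\mu+\nu}e_{r,i}$; for $T\subseteq\mathrm{mon}(\Lambda^r)$, $\langle T\rangle=\{x^\mu t\mid \mu\in\mathbb N^d,\ t\in T\}$ is the orbit of $T$. A subset $S\subseteq L$ of a submodule $L\subseteq\Lambda^r$ is a standard basis of $L$ with respect to $\prec$ if $\langle\mathrm{lm}(S)\rangle=\mathrm{lm}(L)$. A non-zero $f\in\Lambda^p$ has a standard representation with respect to $\{s_1,\dots,s_q\}$ and $\prec$ if there exist $c_1,\dots,c_q\in\Lambda$ with $f=c_1s_1+\cdots+c_qs_q$ and $\mathrm{lm}(f)=\min_\prec\{\mathrm{lm}(c_js_j)\mid 1\le j\le q,\ c_j\ne0\}$. *)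

theory Defs
  imports "HOL-Analysis.Finite_Cartesian_Product"
begin

section \<open>Formal power series in several variables\<close>

text \<open>
  The variables are indexed by a finite type \<^typ>\<open>'d\<close>, so that \<open>d\<close> is \<open>CARD('d)\<close>. The
  monomial with exponents \<open>\<mu>\<close> is represented by \<open>\<mu> :: nat ^ 'd\<close>; hence the product of
  monomials is addition, and the monomial \<open>1\<close> is \<open>0\<close>.
\<close>

typedef ('a, 'd) mfps = "UNIV :: (nat ^ 'd::finite \<Rightarrow> 'a) set"
  morphisms mfps_coeff Abs_mfps ..

lemma mfps_eqI: "(\<And>\<mu>. mfps_coeff f \<mu> = mfps_coeff g \<mu>) \<Longrightarrow> f = g"
  by (simp add: mfps_coeff_inject[symmetric] fun_eq_iff)

lemma mfps_coeff_Abs [simp]: "mfps_coeff (Abs_mfps F) = F"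
  by (simp add: Abs_mfps_inverse)

abbreviation sum_decomps :: "nat ^ 'd::finite \<Rightarrow> ((nat ^ 'd) \<times> (nat ^ 'd)) set"
  where "sum_decomps \<mu> \<equiv> {(\<alpha>, \<beta>). \<alpha> + \<beta> = \<mu>}"

lemma finite_sum_decomps [simp]: "finite (sum_decomps \<mu>)"
proof (rule finite_subset)
  let ?B = "{\<alpha>. \<forall>i. \<alpha> $ i \<le> \<mu> $ i}"
  show "sum_decomps \<mu> \<subseteq> ?B \<times> ?B"
    by auto
  have "vec_nth ` ?B \<subseteq> Pi\<^sub>E UNIV (\<lambda>i. {..\<mu> $ i})"
    by (auto simp: PiE_def)
  then have "finite (vec_nth ` ?B)"
    by (rule finite_subset) (intro finite_PiE; simp)
  then have "finite ?B"
    by (rule finite_imageD) (auto simp: inj_on_def vec_nth_inject)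
  then show "finite (?B \<times> ?B)"
    by simp
qed

instantiation mfps :: (comm_ring_1, finite) comm_ring_1
begin

definition "0 = Abs_mfps (\<lambda>_. 0)"

definition "1 = Abs_mfps (\<lambda>\<mu>. if \<mu> = 0 then 1 else 0)"

definition "f + g = Abs_mfps (\<lambda>\<mu>. mfps_coeff f \<mu> + mfps_coeff g \<mu>)"

definition "f - g = Abs_mfps (\<lambda>\<mu>. mfps_coeff f \<mu> - mfps_coeff g \<mu>)"

definition "- f = Abs_mfps (\<lambda>\<mu>. - mfps_coeff f \<mu>)"

definition "f * g =
  Abs_mfps (\<lambda>\<mu>. \<Sum>(\<alpha>, \<beta>)\<in>sum_decomps \<mu>. mfps_coeff f \<alpha> * mfps_coeff g \<beta>)"

instance
proof
  fix f g h :: "('a, 'b) mfps"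
  show "f + g + h = f + (g + h)" "f + g = g + f" "0 + f = f" "- f + f = 0" "f - g = f + - g"
    by (simp_all add: plus_mfps_def zero_mfps_def uminus_mfps_def minus_mfps_def
        mfps_eqI add_ac mfps_coeff_inverse)
  show "f * g = g * f"
    unfolding times_mfps_def
    by (intro arg_cong[where f = Abs_mfps] ext
        sum.reindex_bij_witness[where i = "\<lambda>(a, b). (b, a)" and j = "\<lambda>(a, b). (b, a)"])
      (auto simp: add.commute mult.commute)
  show "(f + g) * h = f * h + g * h"
    by (simp add: plus_mfps_def times_mfps_def case_prod_beta distrib_right sum.distrib)
  show "(0 :: ('a, 'b) mfps) \<noteq> 1"
    by (auto simp: zero_mfps_def one_mfps_def Abs_mfps_inject fun_eq_iff)
  show "1 * f = f"
  proof (rule mfps_eqI)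
    fix \<mu>
    have "mfps_coeff (1 * f) \<mu> =
        (\<Sum>(\<alpha>, \<beta>)\<in>sum_decomps \<mu>. (if \<alpha> = 0 then 1 else 0) * mfps_coeff f \<beta>)"
      by (simp add: times_mfps_def one_mfps_def)
    also have "\<dots> = (\<Sum>(\<alpha>, \<beta>)\<in>{(0 :: nat ^ 'b, \<mu>)}. (if \<alpha> = 0 then 1 else 0) * mfps_coeff f \<beta>)"
      by (rule sum.mono_neutral_right) (auto split: if_splits)
    finally show "mfps_coeff (1 * f) \<mu> = mfps_coeff f \<mu>"
      by simp
  qed
  show "f * g * h = f * (g * h)"
  proof (rule mfps_eqI)
    fix \<mu>
    let ?f = "mfps_coeff f" and ?g = "mfps_coeff g" and ?h = "mfps_coeff h"
    have "mfps_coeff (f * g * h) \<mu> =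
        (\<Sum>p\<in>sum_decomps \<mu>. \<Sum>q\<in>sum_decomps (fst p). ?f (fst q) * ?g (snd q) * ?h (snd p))"
      by (simp add: times_mfps_def case_prod_beta sum_distrib_right)
    also have "\<dots> = (\<Sum>(p, q)\<in>Sigma (sum_decomps \<mu>) (\<lambda>p. sum_decomps (fst p)).
        ?f (fst q) * ?g (snd q) * ?h (snd p))"
      by (rule sum.Sigma) auto
    also have "\<dots> = (\<Sum>(p, q)\<in>Sigma (sum_decomps \<mu>) (\<lambda>p. sum_decomps (snd p)).
        ?f (fst p) * (?g (fst q) * ?h (snd q)))"
      by (rule sum.reindex_bij_witness
          [where i = "\<lambda>((a, b), (c, e)). ((a + c, e), (a, c))"
            and j = "\<lambda>((a, b), (c, e)). ((c, e + b), (e, b))"])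
        (auto simp: add.assoc mult.assoc)
    also have "\<dots> =
        (\<Sum>p\<in>sum_decomps \<mu>. \<Sum>q\<in>sum_decomps (snd p). ?f (fst p) * (?g (fst q) * ?h (snd q)))"
      by (rule sum.Sigma[symmetric]) auto
    also have "\<dots> = mfps_coeff (f * (g * h)) \<mu>"
      by (simp add: times_mfps_def case_prod_beta sum_distrib_left)
    finally show "mfps_coeff (f * g * h) \<mu> = mfps_coeff (f * (g * h)) \<mu>" .
  qed
qed

end

text \<open>The free module of rank \<open>CARD('p)\<close> over the power series ring.\<close>

global_interpretation mfps_vec: module
  "(*s) :: ('a::comm_ring_1, 'd::finite) mfps \<Rightarrow> ('a, 'd) mfps ^ 'p::finite \<Rightarrow> ('a, 'd) mfps ^ 'p"
  by standard (simp_all add: vec_eq_iff algebra_simps)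


section \<open>Monomial orders\<close>

definition strict_total_order :: "('m \<Rightarrow> 'm \<Rightarrow> bool) \<Rightarrow> bool" where
  "strict_total_order prec \<longleftrightarrow> irreflp prec \<and> transp prec \<and> totalp prec"

definition monomial_order :: "(nat ^ 'd::finite \<Rightarrow> nat ^ 'd \<Rightarrow> bool) \<Rightarrow> bool" where
  "monomial_order prec \<longleftrightarrow> strict_total_order prec \<and>
     (\<forall>\<mu>. \<mu> \<noteq> 0 \<longrightarrow> prec 0 \<mu>) \<and>
     (\<forall>\<mu> \<mu>' \<nu>. prec \<mu> \<mu>' \<longrightarrow> prec (\<mu> + \<nu>) (\<mu>' + \<nu>))"

text \<open>The monomial \<open>x\<^sup>\<mu> e\<^sub>i\<close> of the free module is represented by the pair \<open>(\<mu>, i)\<close>.\<close>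

type_synonym ('d, 'p) mmon = "(nat ^ 'd) \<times> 'p"

definition module_monomial_order :: "(('d::finite, 'p) mmon \<Rightarrow> ('d, 'p) mmon \<Rightarrow> bool) \<Rightarrow> bool" where
  "module_monomial_order prec \<longleftrightarrow> strict_total_order prec \<and>
     (\<exists>prec0. monomial_order prec0 \<and> (\<forall>\<mu> \<nu> i. prec0 \<mu> \<nu> \<longrightarrow> prec (\<mu>, i) (\<nu>, i))) \<and>
     (\<forall>\<mu> \<mu>' \<nu> i j. prec (\<mu>, i) (\<mu>', j) \<longrightarrow> prec (\<mu> + \<nu>, i) (\<mu>' + \<nu>, j))"


section \<open>Leading monomials and standard bases\<close>

definition supp :: "('a::zero, 'd::finite) mfps ^ 'p::finite \<Rightarrow> ('d, 'p) mmon set" where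
  "supp f = {(\<mu>, i). mfps_coeff (f $ i) \<mu> \<noteq> 0}"

text \<open>A module monomial order is a well-order, so minima exist for all non-empty sets.\<close>

definition min_wrt :: "('m \<Rightarrow> 'm \<Rightarrow> bool) \<Rightarrow> 'm set \<Rightarrow> 'm" where
  "min_wrt prec T = (THE m. m \<in> T \<and> (\<forall>m'\<in>T. m' \<noteq> m \<longrightarrow> prec m m'))"

definition lm :: "(('d, 'p) mmon \<Rightarrow> ('d, 'p) mmon \<Rightarrow> bool) \<Rightarrow>
    ('a::zero, 'd::finite) mfps ^ 'p::finite \<Rightarrow> ('d, 'p) mmon" where
  "lm prec f = min_wrt prec (supp f)"

definition lm_set :: "(('d, 'p) mmon \<Rightarrow> ('d, 'p) mmon \<Rightarrow> bool) \<Rightarrow>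
    (('a::comm_ring_1, 'd::finite) mfps ^ 'p::finite) set \<Rightarrow> ('d, 'p) mmon set" where
  "lm_set prec S = lm prec ` (S - {0})"

definition orbit :: "('d::finite, 'p) mmon set \<Rightarrow> ('d, 'p) mmon set" where
  "orbit T = {(\<mu> + \<nu>, i) |\<mu> \<nu> i. (\<nu>, i) \<in> T}"

definition is_standard_basis :: "(('d, 'p) mmon \<Rightarrow> ('d, 'p) mmon \<Rightarrow> bool) \<Rightarrow>
    (('a::comm_ring_1, 'd::finite) mfps ^ 'p::finite) set \<Rightarrow>
    (('a, 'd) mfps ^ 'p) set \<Rightarrow> bool" where
  "is_standard_basis prec L S \<longleftrightarrow>
     mfps_vec.subspace L \<and> S \<subseteq> L \<and> orbit (lm_set prec S) = lm_set prec L"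

definition has_standard_representation :: "(('d, 'p) mmon \<Rightarrow> ('d, 'p) mmon \<Rightarrow> bool) \<Rightarrow>
    nat \<Rightarrow> (nat \<Rightarrow> ('a::comm_ring_1, 'd::finite) mfps ^ 'p::finite) \<Rightarrow>
    ('a, 'd) mfps ^ 'p \<Rightarrow> bool" where
  "has_standard_representation prec q s f \<longleftrightarrow> f \<noteq> 0 \<and>
     (\<exists>c. f = (\<Sum>j = 1..q. c j *s s j) \<and>
          lm prec f = min_wrt prec {lm prec (c j *s s j) |j. j \<in> {1..q} \<and> c j \<noteq> 0})"

end

theory Submission
  imports Defs
begin

text \<open>
  Everything follows from a division theorem: each \<open>f\<close> can be written as
  \<open>c\<^sub>1 s\<^sub>1 + \<dots> + c\<^sub>q s\<^sub>q + r\<close>, where no monomial of \<open>r\<close> lies in the orbit of the leading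
  monomials and all monomials of the \<open>c\<^sub>j s\<^sub>j\<close> are at least \<open>lm f\<close>. To prove it, assign every
  monomial \<open>m\<close> of the orbit to one generator \<open>s\<^sub>j\<close> such that \<open>m\<close> is a multiple \<open>x\<^sup>\<alpha> \<cdot> lm s\<^sub>j\<close>, and
  only use such \<open>x\<^sup>\<alpha>\<close> in \<open>c\<^sub>j\<close>. The unknown coefficients of \<open>c\<^sub>1, \<dots>, c\<^sub>q, r\<close> are then indexed by
  the monomials of the free module, and they satisfy a linear system that is triangular with
  respect to the monomial order. This order is well-founded by Dickson's lemma, so the system is
  solved by well-founded recursion; no topology is needed, although the order type may exceed
  \<open>\<omega>\<close>.
\<close>

section \<open>Well-foundedness of module monomial orders\<close>

text \<open>Dickson's lemma in sequence form. The coordinates are treated one at a time: thinning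
  out a sequence further keeps the coordinates that are already monotone monotone.\<close>

lemma nat_vec_monotone_subseq:
  fixes f :: "nat \<Rightarrow> nat ^ 'd::finite"
  shows "\<exists>g :: nat \<Rightarrow> nat. strict_mono g \<and> (\<forall>i. mono (\<lambda>n. f (g n) $ i))"
proof -
  have "\<exists>g :: nat \<Rightarrow> nat. strict_mono g \<and> (\<forall>i\<in>I. mono (\<lambda>n. f (g n) $ i))" if "finite I" for I :: "'d set"
    using that
  proof (induction I rule: finite_induct)
    case empty
    show ?case
      by (rule exI[of _ id]) (simp add: strict_mono_def)
  next
    case (insert i I)
    then obtain g :: "nat \<Rightarrow> nat" where g: "strict_mono g" "\<And>j. j \<in> I \<Longrightarrow> mono (\<lambda>n. f (g n) $ j)"
      by auto
    \<comment> \<open>\<open>A n\<close> is the minimum of coordinate i over the tail from n on, and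
      \<open>w n\<close> will be an index in that tail attaining it.\<close>
    define A where "A n = (LEAST k. \<exists>m\<ge>n. f (g m) $ i = k)" for n
    have A_le: "A n \<le> f (g m) $ i" if "n \<le> m" for n m
      unfolding A_def by (rule Least_le) (use that in auto)
    have A_ex: "\<exists>m\<ge>n. f (g m) $ i = A n" for n
      unfolding A_def by (rule LeastI_ex) auto
    then obtain w where w: "\<And>n. n \<le> w n" "\<And>n. f (g (w n)) $ i = A n"
      by metis
    define h where "h = rec_nat (w 0) (\<lambda>_ m. w (Suc m))"
    have h_Suc: "h (Suc n) = w (Suc (h n))" for n
      by (simp add: h_def)
    have h: "strict_mono h"
      unfolding strict_mono_Suc_iff h_Suc using w(1) by (meson Suc_le_lessD)
    \<comment> \<open>The value at \<open>h n\<close> is thus the minimum of a tail that also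
      contains \<open>h (Suc n)\<close>, so the next value cannot be smaller.\<close>
    have "\<exists>k. h n = w k \<and> k \<le> h n" for n
      by (cases n) (use w(1) in \<open>auto simp: h_def\<close>)
    then have "f (g (h n)) $ i \<le> f (g (h (Suc n))) $ i" for n
      using A_le w(2) strict_monoD[OF h lessI, of n] by (metis le_trans less_imp_le)
    then have "mono (\<lambda>n. f (g (h n)) $ i)"
      by (simp add: mono_iff_le_Suc)
    moreover have "mono (\<lambda>n. f (g (h n)) $ j)" if "j \<in> I" for j
      using g(2)[OF that] strict_mono_mono[OF h] by (auto simp: mono_def)
    ultimately show ?case
      using strict_mono_o[OF g(1) h] by (intro exI[of _ "g \<circ> h"]) (auto simp: o_def)
  qed
  from this[OF finite[of UNIV]] show ?thesis
    by simp
qed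

locale module_order =
  fixes prec :: "('d::finite, 'p::finite) mmon \<Rightarrow> ('d, 'p) mmon \<Rightarrow> bool" (infix "\<prec>" 50)
  assumes order: "module_monomial_order prec"
begin

abbreviation preceq :: "('d, 'p) mmon \<Rightarrow> ('d, 'p) mmon \<Rightarrow> bool" (infix "\<preceq>" 50)
  where "m \<preceq> n \<equiv> m = n \<or> m \<prec> n"

lemma prec_irrefl: "\<not> m \<prec> m"
  and prec_trans: "m \<prec> n \<Longrightarrow> n \<prec> k \<Longrightarrow> m \<prec> k"
  and prec_total: "m \<prec> n \<or> m = n \<or> n \<prec> m"
  using order unfolding module_monomial_order_def strict_total_order_def
  by (auto dest: irreflpD transpD totalpD)

lemma prec_add: "(\<mu>, i) \<prec> (\<mu>', j) \<Longrightarrow> (\<nu> + \<mu>, i) \<prec> (\<nu> + \<mu>', j)"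
  using order unfolding module_monomial_order_def by (metis add.commute)

lemma preceq_add: "(\<mu>, i) \<preceq> (\<mu>', j) \<Longrightarrow> (\<nu> + \<mu>, i) \<preceq> (\<nu> + \<mu>', j)"
  using prec_add by auto

text \<open>Here the compatible order on the ring monomials enters: x^\<nu> is above 1, this carries
  over to component i, and multiplying by x^\<mu> gives the claim.\<close>

lemma preceq_self_add: "(\<mu>, i) \<preceq> (\<nu> + \<mu>, i)"
proof (cases "\<nu> = 0")
  case False
  obtain prec0 where "monomial_order prec0" "\<And>\<mu> \<nu> i. prec0 \<mu> \<nu> \<Longrightarrow> (\<mu>, i) \<prec> (\<nu>, i)"
    using order unfolding module_monomial_order_def by auto
  then have "(0, i) \<prec> (\<nu>, i)"
    using False unfolding monomial_order_def by blast
  from prec_add[OF this, of \<mu>] show ?thesis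
    by (simp add: add.commute)
qed auto

text \<open>An infinite descending chain would contain a subsequence with coordinatewise
  nondecreasing exponents. Two of its members share a component by the pigeonhole principle, and the
  later one is then a multiple of the earlier one, hence not below it.\<close>

lemma prec_wfp: "wfp (\<prec>)"
  unfolding wfp_def wf_iff_no_infinite_down_chain
proof
  assume "\<exists>f. \<forall>n. (f (Suc n), f n) \<in> {(m, n). m \<prec> n}"
  then obtain f where desc: "\<And>n. f (Suc n) \<prec> f n"
    by blast
  have desc': "f n \<prec> f m" if "m < n" for m n
    using that by (induction rule: less_Suc_induct) (auto intro: desc prec_trans)
  obtain g :: "nat \<Rightarrow> nat" where g: "strict_mono g" "\<And>i. mono (\<lambda>n. fst (f (g n)) $ i)"
    using nat_vec_monotone_subseq[of "fst \<circ> f"] by auto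
  have "\<not> inj (\<lambda>n. snd (f (g n)))"
    using finite_imageD[of "\<lambda>n. snd (f (g n))" UNIV] by auto
  then obtain m n where "m < n" and eq: "snd (f (g m)) = snd (f (g n))"
    unfolding inj_def by (metis linorder_neqE_nat)
  \<comment> \<open>Monotonicity makes the truncated subtraction exact.\<close>
  have "fst (f (g n)) = (fst (f (g n)) - fst (f (g m))) + fst (f (g m))"
    using g(2) \<open>m < n\<close> by (simp add: vec_eq_iff mono_def)
  with eq have "f (g m) \<preceq> f (g n)"
    using preceq_self_add by (metis prod.collapse)
  with desc'[of "g m" "g n"] g(1) \<open>m < n\<close> show False
    by (metis prec_irrefl prec_trans strict_monoD)
qed

text \<open>Well-foundedness provides a minimal element and totality makes it least, so the
  description in \<open>min_wrt\<close> denotes.\<close>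

lemma min_wrt:
  assumes "T \<noteq> {}"
  shows min_wrt_in: "min_wrt prec T \<in> T" and min_wrt_le: "m \<in> T \<Longrightarrow> min_wrt prec T \<preceq> m"
proof -
  obtain z where z: "z \<in> T" "\<And>y. y \<prec> z \<Longrightarrow> y \<notin> T"
    using prec_wfp assms unfolding wfp_iff_ex_minimal by blast
  have "min_wrt prec T = z"
    unfolding min_wrt_def
  proof (rule the_equality)
    show "z \<in> T \<and> (\<forall>m\<in>T. m \<noteq> z \<longrightarrow> z \<prec> m)"
      using z prec_total by metis
  qed (use z in metis)
  with z prec_total show "min_wrt prec T \<in> T" "m \<in> T \<Longrightarrow> min_wrt prec T \<preceq> m"
    by metis+
qed

lemma min_wrt_eqI:
  assumes "m \<in> T" "\<And>n. n \<in> T \<Longrightarrow> m \<preceq> n"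
  shows "min_wrt prec T = m"
proof -
  have "T \<noteq> {}"
    using assms(1) by blast
  from assms(2)[OF min_wrt_in[OF this]] min_wrt_le[OF this assms(1)] show ?thesis
    using prec_irrefl prec_trans by metis
qed

end


section \<open>Supports and leading monomials\<close>

lemma mfps_coeff_0 [simp]: "mfps_coeff 0 \<mu> = 0"
  by (simp add: zero_mfps_def)

lemma mfps_coeff_add [simp]: "mfps_coeff (f + g) \<mu> = mfps_coeff f \<mu> + mfps_coeff g \<mu>"
  by (simp add: plus_mfps_def)

lemma mfps_coeff_sum: "mfps_coeff (sum f A) \<mu> = (\<Sum>x\<in>A. mfps_coeff (f x) \<mu>)"
  by (induction A rule: infinite_finite_induct) auto

lemma mfps_coeff_scale:
  "mfps_coeff ((c *s v) $ i) \<mu> = (\<Sum>(\<alpha>, \<beta>)\<in>sum_decomps \<mu>. mfps_coeff c \<alpha> * mfps_coeff (v $ i) \<beta>)"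
  by (simp add: times_mfps_def)

lemma mfps_eq_0_iff: "c = 0 \<longleftrightarrow> (\<forall>\<mu>. mfps_coeff c \<mu> = 0)"
  using mfps_eqI[of c 0] by auto

lemma in_supp_iff: "(\<mu>, i) \<in> supp f \<longleftrightarrow> mfps_coeff (f $ i) \<mu> \<noteq> 0"
  by (simp add: supp_def)

lemma supp_eq_empty_iff: "supp f = {} \<longleftrightarrow> f = 0"
  for f :: "('a::comm_ring_1, 'd::finite) mfps ^ 'p::finite"
  by (auto simp: supp_def vec_eq_iff mfps_eq_0_iff)

lemma supp_diff_subset: "supp (f - g) \<subseteq> supp f \<union> supp g"
  for f :: "('a::comm_ring_1, 'd::finite) mfps ^ 'p::finite"
  by (auto simp: supp_def minus_mfps_def)

lemma supp_sum_subset: "supp (sum f A) \<subseteq> (\<Union>x\<in>A. supp (f x))"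
  for f :: "'x \<Rightarrow> ('a::comm_ring_1, 'd::finite) mfps ^ 'p::finite"
  by (auto simp: supp_def mfps_coeff_sum dest: sum.not_neutral_contains_not_neutral)

lemma supp_scaleE:
  assumes "(\<mu>, i) \<in> supp (c *s v)"
  obtains \<alpha> \<beta> where "\<mu> = \<alpha> + \<beta>" "mfps_coeff c \<alpha> \<noteq> 0" "(\<beta>, i) \<in> supp v"
proof -
  have "(\<Sum>(\<alpha>, \<beta>)\<in>sum_decomps \<mu>. mfps_coeff c \<alpha> * mfps_coeff (v $ i) \<beta>) \<noteq> 0"
    using assms by (simp add: in_supp_iff mfps_coeff_scale del: vector_smult_component)
  then obtain p where "p \<in> sum_decomps \<mu>"
      "(case p of (\<alpha>, \<beta>) \<Rightarrow> mfps_coeff c \<alpha> * mfps_coeff (v $ i) \<beta>) \<noteq> 0"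
    by (rule sum.not_neutral_contains_not_neutral)
  then obtain \<alpha> \<beta> where "\<mu> = \<alpha> + \<beta>" "mfps_coeff c \<alpha> * mfps_coeff (v $ i) \<beta> \<noteq> 0"
    by (cases p) auto
  then show thesis
    by (intro that) (auto simp: in_supp_iff)
qed

section \<open>Leading monomials of non-zero elements and of their multiples\<close>

context module_order
begin

context
  fixes f :: "('a::comm_ring_1, 'd) mfps ^ 'p"
  assumes "f \<noteq> 0"
begin

lemma lm_in_supp: "lm prec f \<in> supp f"
  using \<open>f \<noteq> 0\<close> by (simp add: lm_def min_wrt_in supp_eq_empty_iff)

lemma lm_le: "m \<in> supp f \<Longrightarrow> lm prec f \<preceq> m"
  using \<open>f \<noteq> 0\<close> unfolding lm_def by (intro min_wrt_le) auto

end

text \<open>The product of the least term of c and the leading term of v is non-zero in a domain,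
  and it cannot cancel because every other product of terms lies at a strictly larger
  monomial.\<close>

lemma lm_scale:
  fixes v :: "('a::idom, 'd) mfps ^ 'p"
  assumes "c \<noteq> 0" "v \<noteq> 0" and lm_v: "lm prec v = (\<beta>\<^sub>0, i\<^sub>0)"
  shows scale_nonzero: "c *s v \<noteq> 0"
    and lm_scale_ex: "\<exists>\<alpha>. mfps_coeff c \<alpha> \<noteq> 0 \<and> lm prec (c *s v) = (\<alpha> + \<beta>\<^sub>0, i\<^sub>0)"
proof -
  \<comment> \<open>The exponents of c are compared inside the component of
    \<open>lm prec v\<close>.\<close>
  let ?T = "{(\<alpha>, i\<^sub>0) |\<alpha>. mfps_coeff c \<alpha> \<noteq> 0}"
  have T: "?T \<noteq> {}"
    using \<open>c \<noteq> 0\<close> by (auto simp: mfps_eq_0_iff)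
  from min_wrt_in[OF T] obtain \<alpha>\<^sub>0
    where \<alpha>\<^sub>0: "mfps_coeff c \<alpha>\<^sub>0 \<noteq> 0" and min: "min_wrt prec ?T = (\<alpha>\<^sub>0, i\<^sub>0)"
    by auto
  have \<alpha>\<^sub>0_le: "(\<alpha>\<^sub>0, i\<^sub>0) \<preceq> (\<alpha>, i\<^sub>0)" if "mfps_coeff c \<alpha> \<noteq> 0" for \<alpha>
    unfolding min[symmetric] by (rule min_wrt_le[OF T]) (use that in blast)
  have v_le: "(\<beta>\<^sub>0, i\<^sub>0) \<preceq> (\<beta>, i)" if "(\<beta>, i) \<in> supp v" for \<beta> i
    using lm_le[OF \<open>v \<noteq> 0\<close> that] lm_v by simp
  \<comment> \<open>Replace first the exponent from c, then the monomial from v; at least one of the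
    two replacements is strict.\<close>
  have less: "(\<alpha>\<^sub>0 + \<beta>\<^sub>0, i\<^sub>0) \<prec> (\<alpha> + \<beta>, i)"
    if "mfps_coeff c \<alpha> \<noteq> 0" "(\<beta>, i) \<in> supp v" "(\<alpha>, \<beta>, i) \<noteq> (\<alpha>\<^sub>0, \<beta>\<^sub>0, i\<^sub>0)" for \<alpha> \<beta> i
  proof -
    have "(\<alpha>\<^sub>0 + \<beta>\<^sub>0, i\<^sub>0) \<preceq> (\<alpha> + \<beta>\<^sub>0, i\<^sub>0)" "\<alpha> \<noteq> \<alpha>\<^sub>0 \<Longrightarrow> (\<alpha>\<^sub>0 + \<beta>\<^sub>0, i\<^sub>0) \<prec> (\<alpha> + \<beta>\<^sub>0, i\<^sub>0)"
      using \<alpha>\<^sub>0_le[OF that(1)] prec_add[of \<alpha>\<^sub>0 i\<^sub>0 \<alpha> i\<^sub>0 \<beta>\<^sub>0] by (auto simp: add.commute)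
    moreover have "(\<alpha> + \<beta>\<^sub>0, i\<^sub>0) \<preceq> (\<alpha> + \<beta>, i)"
        "(\<beta>, i) \<noteq> (\<beta>\<^sub>0, i\<^sub>0) \<Longrightarrow> (\<alpha> + \<beta>\<^sub>0, i\<^sub>0) \<prec> (\<alpha> + \<beta>, i)"
      using v_le[OF that(2)] prec_add[of \<beta>\<^sub>0 i\<^sub>0 \<beta> i \<alpha>] by auto
    ultimately show ?thesis
      using that(3) prec_trans by (metis (no_types, lifting))
  qed
  have "mfps_coeff ((c *s v) $ i\<^sub>0) (\<alpha>\<^sub>0 + \<beta>\<^sub>0) =
      (\<Sum>(\<alpha>, \<beta>)\<in>{(\<alpha>\<^sub>0, \<beta>\<^sub>0)}. mfps_coeff c \<alpha> * mfps_coeff (v $ i\<^sub>0) \<beta>)"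
    unfolding mfps_coeff_scale
  proof (rule sum.mono_neutral_right)
    show "\<forall>p\<in>sum_decomps (\<alpha>\<^sub>0 + \<beta>\<^sub>0) - {(\<alpha>\<^sub>0, \<beta>\<^sub>0)}.
        (case p of (\<alpha>, \<beta>) \<Rightarrow> mfps_coeff c \<alpha> * mfps_coeff (v $ i\<^sub>0) \<beta>) = 0"
      using less prec_irrefl by (fastforce simp: in_supp_iff)
  qed auto
  moreover have "mfps_coeff (v $ i\<^sub>0) \<beta>\<^sub>0 \<noteq> 0"
    using lm_in_supp[OF \<open>v \<noteq> 0\<close>] lm_v by (simp add: in_supp_iff)
  ultimately have in_supp: "(\<alpha>\<^sub>0 + \<beta>\<^sub>0, i\<^sub>0) \<in> supp (c *s v)"
    using \<alpha>\<^sub>0 by (simp add: in_supp_iff del: vector_smult_component)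
  then show "c *s v \<noteq> 0"
    using supp_eq_empty_iff by blast
  have "(\<alpha>\<^sub>0 + \<beta>\<^sub>0, i\<^sub>0) \<preceq> m" if "m \<in> supp (c *s v)" for m
    using that less by (cases m) (auto elim!: supp_scaleE)
  with in_supp have "lm prec (c *s v) = (\<alpha>\<^sub>0 + \<beta>\<^sub>0, i\<^sub>0)"
    unfolding lm_def by (intro min_wrt_eqI)
  with \<alpha>\<^sub>0 show "\<exists>\<alpha>. mfps_coeff c \<alpha> \<noteq> 0 \<and> lm prec (c *s v) = (\<alpha> + \<beta>\<^sub>0, i\<^sub>0)"
    by blast
qed


section \<open>Division\<close>

text \<open>The first assumption says that the equation at m involves \<open>h m\<close> with the
  invertible factor \<open>u m\<close>, and otherwise only unknowns at smaller monomials. So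
  \<open>g m\<close> can be solved for by recursion along the order. The bound on where g is
  non-zero serves to control the supports of the quotients.\<close>

lemma triangular_solve:
  fixes \<Phi> :: "(('d, 'p) mmon \<Rightarrow> 'a::field) \<Rightarrow> ('d, 'p) mmon \<Rightarrow> 'a"
  assumes \<Phi>: "\<And>h m. \<Phi> h m = u m * h m + \<Phi> (\<lambda>n. if n \<prec> m then h n else 0) m"
    and \<Phi>_0: "\<And>m. \<Phi> (\<lambda>_. 0) m = 0"
    and u: "\<And>m. u m \<noteq> 0"
  obtains g where "\<Phi> g = f" "\<And>m. g m \<noteq> 0 \<Longrightarrow> \<exists>n. n \<preceq> m \<and> f n \<noteq> 0"
proof
  define F where "F g m = (f m - \<Phi> (\<lambda>n. if n \<prec> m then g n else 0) m) / u m" for g m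
  define g where "g = wfrec {(n, m). n \<prec> m} F"
  \<comment> \<open>\<open>F g m\<close> consults g only below m, so the recursion equation
    holds.\<close>
  have "adm_wf {(n, m). n \<prec> m} F"
    unfolding adm_wf_def F_def
    by (intro allI impI arg_cong[where f = "\<lambda>h. (f _ - \<Phi> h _) / u _"] ext) auto
  then have g: "g m = F g m" for m
    unfolding g_def using prec_wfp by (subst wfrec_fixpoint) (auto simp: wfp_def)
  show "\<Phi> g = f"
  proof
    fix m
    show "\<Phi> g m = f m"
      by (subst \<Phi>, subst g) (simp add: F_def u)
  qed
  show "\<exists>n. n \<preceq> m \<and> f n \<noteq> 0" if "g m \<noteq> 0" for m
    using prec_wfp that
  proof (induction m rule: wfp_induct_rule)
    case (less m)
    show ?case
    proof (rule ccontr)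
      assume *: "\<not> ?case"
      \<comment> \<open>If f vanishes at and below m, the induction hypothesis makes g vanish below
        m; the equation at m then reads \<open>u m * g m = 0\<close>.\<close>
      then have "(\<lambda>n. if n \<prec> m then g n else 0) = (\<lambda>_. 0)"
        using less.IH prec_trans by (metis (no_types, lifting))
      with * less.prems show False
        by (cases m, subst (asm) g) (auto simp: F_def \<Phi>_0)
    qed
  qed
qed

text \<open>The order bound refers to monomials of f rather than to \<open>lm prec f\<close>, so it
  is meaningful for f = 0 too.\<close>

lemma division:
  fixes s :: "'x \<Rightarrow> ('a::field, 'd) mfps ^ 'p" and f :: "('a, 'd) mfps ^ 'p"
  assumes "finite K" and s: "\<And>j. j \<in> K \<Longrightarrow> s j \<noteq> 0"
  obtains c r where "f = (\<Sum>j\<in>K. c j *s s j) + r" "supp r \<inter> orbit (lm_set prec (s ` K)) = {}"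
    "\<And>j m. j \<in> K \<Longrightarrow> m \<in> supp (c j *s s j) \<Longrightarrow> \<exists>n\<in>supp f. n \<preceq> m"
proof -
  define b where "b j = fst (lm prec (s j))" for j
  define e where "e j = snd (lm prec (s j))" for j
  define Orb where "Orb = orbit (lm_set prec (s ` K))"
  have Orb_iff: "(\<mu>, i) \<in> Orb \<longleftrightarrow> (\<exists>j\<in>K. \<exists>\<alpha>. \<mu> = \<alpha> + b j \<and> i = e j)" for \<mu> i
  proof -
    have "lm_set prec (s ` K) = {(b j, e j) |j. j \<in> K}"
      using s by (auto simp: lm_set_def b_def e_def image_iff)
    then show ?thesis
      by (auto simp: Orb_def orbit_def)
  qed
  define J where "J m = (SOME j. j \<in> K \<and> (\<exists>\<alpha>. m = (\<alpha> + b j, e j)))" for m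
  have J: "J m \<in> K \<and> (\<exists>\<alpha>. m = (\<alpha> + b (J m), e (J m)))" if "m \<in> Orb" for m
    unfolding J_def by (rule someI_ex) (use that Orb_iff in \<open>cases m; auto\<close>)
  \<comment> \<open>The coefficients of \<open>c j\<close> in terms of the unknowns h: each orbit
    monomial supplies the coefficient of only the quotient chosen by J.\<close>
  define C where "C h j \<alpha> = (if J (\<alpha> + b j, e j) = j then h (\<alpha> + b j, e j) else 0)"
    for h :: "('d, 'p) mmon \<Rightarrow> 'a" and j \<alpha>
  \<comment> \<open>The coefficient at m of the combination of the \<open>s j\<close> plus r, where
    the unknowns outside the orbit are the coefficients of r.\<close>
  define \<Phi> where "\<Phi> h m = (\<Sum>j\<in>K. \<Sum>(\<alpha>, \<beta>)\<in>sum_decomps (fst m).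
      C h j \<alpha> * mfps_coeff (s j $ snd m) \<beta>) + (if m \<in> Orb then 0 else h m)" for h m
  \<comment> \<open>The diagonal of the system: a leading coefficient on the orbit, and 1 off the
    orbit, where \<open>h m\<close> is itself a coefficient of r.\<close>
  define u where "u m = (if m \<in> Orb then mfps_coeff (s (J m) $ snd m) (b (J m)) else 1)" for m
  have lm_s: "mfps_coeff (s j $ e j) (b j) \<noteq> 0" if "j \<in> K" for j
    using lm_in_supp[OF s[OF that]] by (cases "lm prec (s j)") (simp add: in_supp_iff b_def e_def)
  have s_le: "(\<alpha> + b j, e j) \<preceq> (\<alpha> + \<beta>, i)" if "j \<in> K" "mfps_coeff (s j $ i) \<beta> \<noteq> 0" for j i \<alpha> \<beta>
    using lm_le[OF s[OF that(1)], of "(\<beta>, i)"] that(2)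
    by (intro preceq_add) (simp add: in_supp_iff b_def e_def)
  have u: "u m \<noteq> 0" for m
    using J[of m] lm_s[of "J m"] by (cases m) (auto simp: u_def)
  have \<Phi>: "\<Phi> h m = u m * h m + \<Phi> (\<lambda>n. if n \<prec> m then h n else 0) m" for h m
  proof -
    obtain \<mu> i where m: "m = (\<mu>, i)"
      by (cases m)
    let ?h = "\<lambda>n. if n \<prec> m then h n else 0"
    \<comment> \<open>\<open>?D\<close> is the diagonal contribution: inside the orbit,
      \<open>h m\<close> enters the equation at m exactly once, multiplied by the leading term of
      \<open>s (J m)\<close>. Any other product with a non-zero factor from \<open>s j\<close> uses
      an unknown strictly below m, which the truncation \<open>?h\<close> leaves unchanged.\<close>
    let ?D = "\<lambda>j \<beta>. if m \<in> Orb \<and> j = J m \<and> \<beta> = b j then u m * h m else 0"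
    have "C h j \<alpha> * mfps_coeff (s j $ i) \<beta> = C ?h j \<alpha> * mfps_coeff (s j $ i) \<beta> + ?D j \<beta>"
      if "j \<in> K" "\<alpha> + \<beta> = \<mu>" for j \<alpha> \<beta>
    proof (cases "(\<alpha> + b j, e j) = m")
      case True
      then have "m \<in> Orb"
        using that(1) by (metis Orb_iff)
      moreover have "\<beta> = b j"
        using True that(2) m by (metis add_left_cancel prod.inject)
      ultimately show ?thesis
        using True m prec_irrefl by (auto simp: C_def u_def)
    next
      case False
      then have "?D j \<beta> = 0"
        using J[of m] that m by auto
      moreover have "(\<alpha> + b j, e j) \<prec> m" if "mfps_coeff (s j $ i) \<beta> \<noteq> 0"
        using s_le[OF \<open>j \<in> K\<close> that, of \<alpha>] False m \<open>\<alpha> + \<beta> = \<mu>\<close> by auto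
      ultimately show ?thesis
        by (auto simp: C_def)
    qed
    then have "(\<Sum>j\<in>K. \<Sum>(\<alpha>, \<beta>)\<in>sum_decomps \<mu>. C h j \<alpha> * mfps_coeff (s j $ i) \<beta>) =
        (\<Sum>j\<in>K. \<Sum>(\<alpha>, \<beta>)\<in>sum_decomps \<mu>. C ?h j \<alpha> * mfps_coeff (s j $ i) \<beta> + ?D j \<beta>)"
      by (intro sum.cong) auto
    also have "\<dots> = (\<Sum>j\<in>K. \<Sum>(\<alpha>, \<beta>)\<in>sum_decomps \<mu>. C ?h j \<alpha> * mfps_coeff (s j $ i) \<beta>) +
        (\<Sum>j\<in>K. \<Sum>(\<alpha>, \<beta>)\<in>sum_decomps \<mu>. ?D j \<beta>)"
      by (simp add: case_prod_beta sum.distrib)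
    also have "(\<Sum>j\<in>K. \<Sum>(\<alpha>, \<beta>)\<in>sum_decomps \<mu>. ?D j \<beta>) = (if m \<in> Orb then u m * h m else 0)"
    proof (cases "m \<in> Orb")
      case True
      then obtain \<alpha>\<^sub>0 where "J m \<in> K" and \<alpha>\<^sub>0: "\<mu> = \<alpha>\<^sub>0 + b (J m)"
        using J m by blast
      \<comment> \<open>Only the chosen generator and the decomposition of \<mu> ending in its
        leading exponent survive.\<close>
      have "(\<Sum>j\<in>K. \<Sum>(\<alpha>, \<beta>)\<in>sum_decomps \<mu>. ?D j \<beta>) =
          (\<Sum>j\<in>{J m}. \<Sum>(\<alpha>, \<beta>)\<in>{(\<alpha>\<^sub>0, b (J m))}. ?D j \<beta>)"
      proof (rule sum.mono_neutral_cong_right)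
        show "{J m} \<subseteq> K"
          using \<open>J m \<in> K\<close> by simp
        show "(\<Sum>(\<alpha>, \<beta>)\<in>sum_decomps \<mu>. ?D j \<beta>) = (\<Sum>(\<alpha>, \<beta>)\<in>{(\<alpha>\<^sub>0, b (J m))}. ?D j \<beta>)"
          if "j \<in> {J m}" for j
          using that \<alpha>\<^sub>0 by (intro sum.mono_neutral_right) (auto split: if_splits)
      qed (use \<open>finite K\<close> in \<open>auto intro!: sum.neutral\<close>)
      with True show ?thesis
        by simp
    qed auto
    finally show ?thesis
      by (simp add: \<Phi>_def m prec_irrefl u_def)
  qed
  have \<Phi>_0: "\<Phi> (\<lambda>_. 0) m = 0" for m
    by (simp add: \<Phi>_def C_def)
  obtain g where g: "\<Phi> g = (\<lambda>m. mfps_coeff (f $ snd m) (fst m))"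
      and g_le: "\<And>m. g m \<noteq> 0 \<Longrightarrow> \<exists>n. n \<preceq> m \<and> mfps_coeff (f $ snd n) (fst n) \<noteq> 0"
    by (rule triangular_solve[OF \<Phi> \<Phi>_0 u, of "\<lambda>m. mfps_coeff (f $ snd m) (fst m)"]) blast
  define c where "c j = Abs_mfps (C g j)" for j
  define r :: "('a, 'd) mfps ^ 'p"
    where "r = (\<chi> i. Abs_mfps (\<lambda>\<mu>. if (\<mu>, i) \<in> Orb then 0 else g (\<mu>, i)))"
  show thesis
  proof
    have "mfps_coeff (f $ i) \<mu> = mfps_coeff (((\<Sum>j\<in>K. c j *s s j) + r) $ i) \<mu>" for i \<mu>
      using fun_cong[OF g, of "(\<mu>, i)"]
      by (simp add: \<Phi>_def c_def r_def mfps_coeff_sum mfps_coeff_scale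
          del: vector_smult_component)
    then show "f = (\<Sum>j\<in>K. c j *s s j) + r"
      by (simp add: vec_eq_iff mfps_eqI)
    show "supp r \<inter> orbit (lm_set prec (s ` K)) = {}"
      by (auto simp: Orb_def[symmetric] supp_def r_def)
  next
    fix j m
    assume j: "j \<in> K" and "m \<in> supp (c j *s s j)"
    then obtain \<alpha> \<beta> i where m: "m = (\<alpha> + \<beta>, i)" "C g j \<alpha> \<noteq> 0" "mfps_coeff (s j $ i) \<beta> \<noteq> 0"
      by (cases m, hypsubst, elim supp_scaleE) (auto simp: c_def in_supp_iff)
    \<comment> \<open>The chain is: some monomial of f, then x^\<alpha> times the leading monomial
      of \<open>s j\<close>, then m.\<close>
    then have "g (\<alpha> + b j, e j) \<noteq> 0"
      by (auto simp: C_def split: if_splits)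
    from g_le[OF this] obtain n where "n \<in> supp f" "n \<preceq> (\<alpha> + b j, e j)"
      by (auto simp: supp_def)
    moreover have "(\<alpha> + b j, e j) \<preceq> m"
      using s_le[OF j m(3)] m(1) by simp
    ultimately show "\<exists>n\<in>supp f. n \<preceq> m"
      using prec_trans[of n "(\<alpha> + b j, e j)" m] by auto
  qed
qed

section \<open>Orbits of leading monomials and standard representations\<close>

lemma orbit_lm_scale:
  fixes v :: "('a::idom, 'd) mfps ^ 'p"
  assumes "v \<in> S" "v \<noteq> 0" "c \<noteq> 0"
  shows "lm prec (c *s v) \<in> orbit (lm_set prec S)"
proof -
  obtain \<beta> i where lm_v: "lm prec v = (\<beta>, i)"
    by (cases "lm prec v")
  then have "(\<beta>, i) \<in> lm_set prec S"
    using assms unfolding lm_set_def by (intro image_eqI[of _ _ v]) auto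
  with lm_scale_ex[OF \<open>c \<noteq> 0\<close> \<open>v \<noteq> 0\<close> lm_v] show ?thesis
    by (auto simp: orbit_def)
qed

text \<open>Multiplying by the single monomial x^\<alpha> stays in L and shifts the leading monomial
  by \<alpha>. For a standard basis only the reverse inclusion is therefore at stake.\<close>

lemma orbit_lm_subset:
  fixes L :: "(('a::idom, 'd) mfps ^ 'p) set"
  assumes L: "mfps_vec.subspace L" and "S \<subseteq> L"
  shows "orbit (lm_set prec S) \<subseteq> lm_set prec L"
proof
  fix m
  assume "m \<in> orbit (lm_set prec S)"
  then obtain \<alpha> \<beta> i v where m: "m = (\<alpha> + \<beta>, i)" and v: "v \<in> S" "v \<noteq> 0" "lm prec v = (\<beta>, i)"
    by (auto simp: orbit_def lm_set_def) metis
  define c :: "('a, 'd) mfps" where "c = Abs_mfps (\<lambda>\<mu>. if \<mu> = \<alpha> then 1 else 0)"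
  have "c \<noteq> 0"
    by (auto simp: mfps_eq_0_iff c_def)
  from lm_scale_ex[OF this v(2,3)] have "lm prec (c *s v) = m"
    by (auto simp: m c_def split: if_splits)
  moreover have "c *s v \<in> L - {0}"
    using scale_nonzero[OF \<open>c \<noteq> 0\<close> v(2,3)] mfps_vec.subspace_scale[OF L] v(1) \<open>S \<subseteq> L\<close> by auto
  ultimately show "m \<in> lm_set prec L"
    by (auto simp: lm_set_def)
qed

text \<open>The bound from division puts \<open>lm prec f\<close> at or below every monomial of
  every summand. Since \<open>lm prec f\<close> must occur in some summand, it is the leading
  monomial of that summand, and the minimum is attained.\<close>

lemma has_standard_representationI:
  fixes s :: "nat \<Rightarrow> ('a::field, 'd) mfps ^ 'p"
  assumes "f \<noteq> 0" and f: "f = (\<Sum>j = 1..q. c j *s s j)" and s: "\<And>j. j \<in> {1..q} \<Longrightarrow> s j \<noteq> 0"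
    and le: "\<And>j m. j \<in> {1..q} \<Longrightarrow> m \<in> supp (c j *s s j) \<Longrightarrow> \<exists>n\<in>supp f. n \<preceq> m"
  shows "has_standard_representation prec q s f"
proof -
  let ?T = "{lm prec (c j *s s j) |j. j \<in> {1..q} \<and> c j \<noteq> 0}"
  have lm_f_le: "lm prec f \<preceq> m" if "j \<in> {1..q}" "m \<in> supp (c j *s s j)" for j m
    using le[OF that] lm_le[OF \<open>f \<noteq> 0\<close>] prec_trans by blast
  have nz: "c j *s s j \<noteq> 0" if "j \<in> {1..q}" "c j \<noteq> 0" for j
    using scale_nonzero[OF that(2) s[OF that(1)]] by (cases "lm prec (s j)")
  obtain j where j: "j \<in> {1..q}" "lm prec f \<in> supp (c j *s s j)"
    using lm_in_supp[OF \<open>f \<noteq> 0\<close>] supp_sum_subset[of "\<lambda>j. c j *s s j" "{1..q}"] f by auto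
  then have "c j *s s j \<noteq> 0"
    using supp_eq_empty_iff by blast
  then have "c j \<noteq> 0" "lm prec (c j *s s j) = lm prec f"
    using lm_le[OF _ j(2)] lm_f_le[OF j(1) lm_in_supp] prec_irrefl prec_trans by (auto, metis)
  then have "lm prec f \<in> ?T"
    using j(1) by force
  moreover have "lm prec f \<preceq> m" if "m \<in> ?T" for m
    using that lm_f_le lm_in_supp nz by blast
  ultimately have "min_wrt prec ?T = lm prec f"
    by (rule min_wrt_eqI)
  with \<open>f \<noteq> 0\<close> f show ?thesis
    unfolding has_standard_representation_def by (intro conjI exI[of _ c]) auto
qed

lemma lm_in_orbit_of_standard_representation:
  fixes s :: "nat \<Rightarrow> ('a::field, 'd) mfps ^ 'p"
  assumes "has_standard_representation prec q s f" and s: "\<And>j. j \<in> {1..q} \<Longrightarrow> s j \<noteq> 0"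
  shows "lm prec f \<in> orbit (lm_set prec (s ` {1..q}))"
proof -
  obtain c where "f \<noteq> 0" and f: "f = (\<Sum>j = 1..q. c j *s s j)"
    and lm_f: "lm prec f = min_wrt prec {lm prec (c j *s s j) |j. j \<in> {1..q} \<and> c j \<noteq> 0}"
      (is "_ = min_wrt _ ?T")
    using assms(1) unfolding has_standard_representation_def by blast
  \<comment> \<open>Only for a non-empty set is \<open>min_wrt\<close> known to be a member; here f
    \<noteq> 0 excludes that all \<open>c j\<close> vanish.\<close>
  have "?T \<noteq> {}"
  proof
    assume "?T = {}"
    then have "c j = 0" if "j \<in> {1..q}" for j
      using that by blast
    then have "f = 0"
      unfolding f by (intro sum.neutral) simp
    with \<open>f \<noteq> 0\<close> show False ..
  qed
  then have "lm prec f \<in> ?T"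
    unfolding lm_f by (rule min_wrt_in)
  then obtain j where "j \<in> {1..q}" "c j \<noteq> 0" "lm prec f = lm prec (c j *s s j)"
    by blast
  with orbit_lm_scale[of "s j" "s ` {1..q}" "c j"] s show ?thesis
    by simp
qed

end


section \<open>The equivalence\<close>

theorem theorem3p3:
  fixes L :: "(('a::field, 'd::finite) mfps ^ 'p::finite) set"
    and s :: "nat \<Rightarrow> ('a, 'd) mfps ^ 'p"
    and q :: nat
    and prec :: "('d, 'p) mmon \<Rightarrow> ('d, 'p) mmon \<Rightarrow> bool"
  assumes "q \<ge> 1"
    and "mfps_vec.subspace L"
    and "\<And>j. j \<in> {1..q} \<Longrightarrow> s j \<in> L \<and> s j \<noteq> 0"
    and "module_monomial_order prec"
  shows "(is_standard_basis prec L (s ` {1..q}) \<longleftrightarrow>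
            mfps_vec.span (s ` {1..q}) = L \<and>
            (\<forall>f. \<exists>!r. f - r \<in> L \<and> supp r \<inter> orbit (lm_set prec (s ` {1..q})) = {}))
       \<and> (is_standard_basis prec L (s ` {1..q}) \<longleftrightarrow>
            (\<forall>f\<in>L. f \<noteq> 0 \<longrightarrow> has_standard_representation prec q s f))"
proof -
  interpret module_order prec
    by standard fact
  let ?S = "s ` {1..q}" and ?O = "orbit (lm_set prec (s ` {1..q}))"
  let ?remainder = "\<lambda>f r. f - r \<in> L \<and> supp r \<inter> ?O = {}"
  note L = assms(2)
  have s: "s j \<noteq> 0" "s j \<in> L" if "j \<in> {1..q}" for j
    using assms(3)[OF that] by auto
  have "?S \<subseteq> L"
    using s by auto
  have basis_iff: "is_standard_basis prec L ?S \<longleftrightarrow> (\<forall>f\<in>L. f \<noteq> 0 \<longrightarrow> lm prec f \<in> ?O)"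
    using L \<open>?S \<subseteq> L\<close> orbit_lm_subset[OF L \<open>?S \<subseteq> L\<close>]
    by (auto simp: is_standard_basis_def lm_set_def)
  have sum_in_L: "(\<Sum>j = 1..q. c j *s s j) \<in> L" for c
    by (intro mfps_vec.subspace_sum mfps_vec.subspace_scale L s)
  \<comment> \<open>The pivot of the equivalence: the remainder of an element of L lies in L and
    avoids the orbit. The premise \<open>zero\<close>, which makes it vanish, will be derived both
    from the standard basis property and from uniqueness of remainders.\<close>
  have standard_repr: "has_standard_representation prec q s f"
    if zero: "\<And>r. r \<in> L \<Longrightarrow> supp r \<inter> ?O = {} \<Longrightarrow> r = 0" and f: "f \<in> L" "f \<noteq> 0" for f
  proof -
    obtain c r where div: "f = (\<Sum>j = 1..q. c j *s s j) + r" "supp r \<inter> ?O = {}"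
      "\<And>j m. j \<in> {1..q} \<Longrightarrow> m \<in> supp (c j *s s j) \<Longrightarrow> \<exists>n\<in>supp f. n \<preceq> m"
      by (rule division[of "{1..q}" s f]) (use s in auto)
    then have "r = f - (\<Sum>j = 1..q. c j *s s j)"
      by simp
    then have "r \<in> L"
      using mfps_vec.subspace_diff[OF L f(1) sum_in_L] by simp
    with zero div(2) have "r = 0"
      by blast
    with div show ?thesis
      using f(2) s by (intro has_standard_representationI) auto
  qed
  \<comment> \<open>Otherwise the leading monomial of r would lie both in its support and in the
    orbit.\<close>
  have zero: "r = 0" if "is_standard_basis prec L ?S" "r \<in> L" "supp r \<inter> ?O = {}" for r
    using that basis_iff lm_in_supp[of r] by auto
  have repr_iff: "is_standard_basis prec L ?S \<longleftrightarrow>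
      (\<forall>f\<in>L. f \<noteq> 0 \<longrightarrow> has_standard_representation prec q s f)"
    using zero standard_repr basis_iff lm_in_orbit_of_standard_representation[of q s] s(1) by blast
  moreover have "mfps_vec.span ?S = L \<and> (\<forall>f. \<exists>!r. ?remainder f r)"
    if basis: "is_standard_basis prec L ?S"
  proof (intro conjI allI)
    show "mfps_vec.span ?S = L"
    proof
      show "mfps_vec.span ?S \<subseteq> L"
        using L \<open>?S \<subseteq> L\<close> by (rule mfps_vec.span_minimal[rotated])
      show "L \<subseteq> mfps_vec.span ?S"
      proof
        fix f
        assume "f \<in> L"
        show "f \<in> mfps_vec.span ?S"
        proof (cases "f = 0")
          case False
          with basis \<open>f \<in> L\<close> repr_iff obtain c where "f = (\<Sum>j = 1..q. c j *s s j)"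
            unfolding has_standard_representation_def by blast
          then show ?thesis
            by (auto intro!: mfps_vec.span_sum mfps_vec.span_scale intro: mfps_vec.span_base)
        qed (simp add: mfps_vec.span_zero)
      qed
    qed
    fix f
    show "\<exists>!r. ?remainder f r"
    proof (rule ex_ex1I)
      obtain c r where "f = (\<Sum>j = 1..q. c j *s s j) + r" "supp r \<inter> ?O = {}"
        by (rule division[of "{1..q}" s f]) (use s in auto)
      then show "\<exists>r. ?remainder f r"
        using sum_in_L by (intro exI[of _ r]) simp
    next
      fix r r'
      assume *: "?remainder f r" "?remainder f r'"
      \<comment> \<open>The difference of two remainders lies in L and avoids the orbit, so
        \<open>zero\<close> applies to it.\<close>
      then have "(f - r') - (f - r) \<in> L"
        using mfps_vec.subspace_diff[OF L] by blast
      then have "r - r' \<in> L"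
        by simp
      moreover have "supp (r - r') \<inter> ?O = {}"
        using * supp_diff_subset[of r r'] by blast
      ultimately show "r = r'"
        using zero[OF basis] by force
    qed
  qed
  moreover have "is_standard_basis prec L ?S" if unique: "\<forall>f. \<exists>!r. ?remainder f r"
  proof -
    have "r = 0" if "r \<in> L" "supp r \<inter> ?O = {}" for r
    proof -
      \<comment> \<open>Such an r has both itself and 0 as remainders, so uniqueness forces r =
        0.\<close>
      have "?remainder r r" "?remainder r 0"
        using that mfps_vec.subspace_0[OF L] by (auto simp: supp_def)
      with unique show ?thesis
        by blast
    qed
    with repr_iff standard_repr show ?thesis
      by blast
  qed
  ultimately show ?thesis
    by blast
qed

end
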